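(* Let $\mathcal{A}^{\mathrm{IC}}=\{(\mathbf{J}_{\mathbf{V}},\mathrm{vSINR}^{\mathrm{IC}}_{\mathbf{V}}) : \mathbf{V}\in\mathbb{C}^{N_T\times(N_T+K)},\ \mathrm{tr}(\mathbf{V}\mathbf{V}^{H})\le P\}$ be the set of pairs (Bayesian Fisher information matrix, SINR vector with interference cancellation) achievable with a full set of $N_T+K$ beamformers under power constraint $P$, in an ISAC system sensing $L$ real parameters and serving $K$ users. Put $$N_{\mathrm{bound}}^{\mathrm{IC}}=\left\lfloor K+\sqrt{\tfrac{L(L+1)}{2}}\right\rfloor .$$ Then for every $(\mathbf{J},\boldsymbol{\gamma})\in\mathcal{A}^{\mathrm{IC}}$ with $\boldsymbol{\gamma}>\mathbf{0}$ (entrywise) there exist an integer $N'$ with $K\le N'\le N_{\mathrm{bound}}^{\mathrm{IC}}$ and $\mathbf{V}'\in\mathbb{C}^{N_T\times N'}$ such that $$\mathbf{J}_{\mathbf{V}'}=\mathbf{J},\qquad \mathrm{vSINR}^{\mathrm{IC}}_{\mathbf{V}'}\ge\boldsymbol{\gamma}\ \text{(entrywise)},\qquad \mathrm{tr}(\mathbf{V}'\mathbf{V}'^{H})\le P .$$ Consequently, the minimum number of beamformers satisfies $N_{\min}^{\mathrm{IC}}\le N_{\mathrm{bound}}^{\mathrm{IC}}$.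
   Context: Integers $N_T,N_R,L,\Upsilon\ge1$, $K\ge0$; reals $\sigma^2>0$, $P>0$; fixed channel vectors $\mathbf{h}_1,\dots,\mathbf{h}_K\in\mathbb{C}^{N_T}$. Beamformers: for $N\ge K$, a beamforming matrix with $N$ beamformers is $\mathbf{V}=[\mathbf{v}_1,\dots,\mathbf{v}_K,\mathbf{V}_s]\in\mathbb{C}^{N_T\times N}$, with communication beamformers $\mathbf{v}_k\in\mathbb{C}^{N_T}$ and sensing beamformers $\mathbf{V}_s\in\mathbb{C}^{N_T\times(N-K)}$. Bayesian Fisher information matrix (BFIM): $\boldsymbol{\eta}\in\mathbb{R}^L$ is a random parameter vector with prior density $f$, and $\mathbf{G}^{(\boldsymbol{\eta})}\in\mathbb{C}^{N_R\times N_T}$ is a known deterministic differentiable function of $\boldsymbol{\eta}$ (all expectations below are assumed to exist). The BFIM is $\mathbf{J}_{\mathbf{V}}=\mathbf{C}+\mathbf{T}_{\mathbf{V}}\in\mathbb{R}^{L\times L}$, where $[\mathbf{C}]_{ij}=-\mathbb{E}[\partial^2\log f(\boldsymbol{\eta})/\partial\eta_i\partial\eta_j]$ ($\mathbf{C}$ is positive semidefinite and does not depend on $\mathbf{V}$) and $[\mathbf{T}_{\mathbf{V}}]_{ij}=\frac{\Upsilon}{\sigma^2}\mathrm{tr}(\tilde{\mathbf{G}}_{ij}\mathbf{V}\mathbf{V}^{H})$ with $\tilde{\mathbf{G}}_{ij}=\mathbb{E}[\dot{\mathbf{G}}_i^{H}\dot{\mathbf{G}}_j+\dot{\mathbf{G}}_j^{H}\dot{\mathbf{G}}_i]$,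 $\dot{\mathbf{G}}_i=\partial\mathbf{G}^{(\boldsymbol{\eta})}/\partial\eta_i$. SINR with interference cancellation (IC): $\mathrm{SINR}^{\mathrm{IC}}_{k,\mathbf{V}}=\dfrac{|\mathbf{h}_k^{H}\mathbf{v}_k|^2}{\sum_{i\ne k}|\mathbf{h}_k^{H}\mathbf{v}_i|^2+\sigma^2}$, and $\mathrm{vSINR}^{\mathrm{IC}}_{\mathbf{V}}=(\mathrm{SINR}^{\mathrm{IC}}_{1,\mathbf{V}},\dots,\mathrm{SINR}^{\mathrm{IC}}_{K,\mathbf{V}})^{T}$. Minimum number of beamformers: let $h$ be a real function on $L\times L$ positive semidefinite matrices that is nondecreasing in the Loewner order, and let $\gamma_k>0$ be given SINR targets. For $N\ge K$ let $p_N^*$ be the optimal value of: minimize $h(\mathbf{J}_{\mathbf{V}}^{-1})$ over $\mathbf{V}\in\mathbb{C}^{N_T\times N}$ subject to $\mathrm{SINR}^{\mathrm{IC}}_{k,\mathbf{V}}\ge\gamma_k$ for all $k$ and $\mathrm{tr}(\mathbf{V}\mathbf{V}^{H})\le P$ (the constraints are assumed strictly feasible). $N_{\min}^{\mathrm{IC}}$ is the smallest $N\ge K$ with $p_N^*=p_{N_T+K}^*$. *)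

theory Defs
  imports "HOL-Probability.Probability"
begin

definition conj_transpose :: "complex^'n^'m \<Rightarrow> complex^'m^'n" where
  "conj_transpose A = (\<chi> i j. cnj (A $ j $ i))"

definition psd :: "real^'n^'n \<Rightarrow> bool" where
  "psd A \<longleftrightarrow> transpose A = A \<and> (\<forall>x. 0 \<le> x \<bullet> (A *v x))"

definition loewner_le :: "real^'n^'n \<Rightarrow> real^'n^'n \<Rightarrow> bool" where
  "loewner_le A B \<longleftrightarrow> psd (B - A)"

definition loewner_nondecreasing :: "(real^'n^'n \<Rightarrow> real) \<Rightarrow> bool" where
  "loewner_nondecreasing \<phi> \<longleftrightarrow>
     (\<forall>A B. psd A \<longrightarrow> psd B \<longrightarrow> loewner_le A B \<longrightarrow> \<phi> A \<le> \<phi> B)"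

definition partially_differentiable ::
    "'l::finite \<Rightarrow> (real^'l \<Rightarrow> 'b::real_normed_vector) \<Rightarrow> real^'l \<Rightarrow> bool" where
  "partially_differentiable i F x \<longleftrightarrow> (\<lambda>t. F (x + t *\<^sub>R axis i 1)) differentiable (at 0)"

definition partial_deriv ::
    "'l::finite \<Rightarrow> (real^'l \<Rightarrow> 'b::real_normed_vector) \<Rightarrow> real^'l \<Rightarrow> 'b" where
  "partial_deriv i F x = vector_derivative (\<lambda>t. F (x + t *\<^sub>R axis i 1)) (at 0)"

definition log_density :: "(real^'l \<Rightarrow> real) \<Rightarrow> real^'l \<Rightarrow> real" where
  "log_density f x = ln (f x)"

(* At x the density is positive and log f has all second order partial derivatives; the
   first order ones must exist in a neighbourhood of x for the second order ones to make
   sense. *)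
definition twice_partially_differentiable_log :: "(real^'l::finite \<Rightarrow> real) \<Rightarrow> real^'l \<Rightarrow> bool" where
  "twice_partially_differentiable_log f x \<longleftrightarrow>
     (\<forall>\<^sub>F y in nhds x. 0 < f y \<and> (\<forall>j. partially_differentiable j (log_density f) y)) \<and>
     (\<forall>i j. partially_differentiable i (partial_deriv j (log_density f)) x)"

definition log_prior_hessian :: "(real^'l::finite \<Rightarrow> real) \<Rightarrow> 'l \<Rightarrow> 'l \<Rightarrow> real^'l \<Rightarrow> real" where
  "log_prior_hessian f i j = partial_deriv i (partial_deriv j (log_density f))"

definition prior_information ::
    "'w measure \<Rightarrow> ('w \<Rightarrow> real^'l::finite) \<Rightarrow> (real^'l \<Rightarrow> real) \<Rightarrow> real^'l^'l" where
  "prior_information M eta f =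
     (\<chi> i j. - prob_space.expectation M (\<lambda>w. log_prior_hessian f i j (eta w)))"

definition response_gram ::
    "(real^'l::finite \<Rightarrow> complex^'nt::finite^'nr::finite) \<Rightarrow> 'l \<Rightarrow> 'l \<Rightarrow> real^'l \<Rightarrow> complex^'nt^'nt" where
  "response_gram G i j x =
     conj_transpose (partial_deriv i G x) ** partial_deriv j G x +
     conj_transpose (partial_deriv j G x) ** partial_deriv i G x"

definition mean_response_gram ::
    "'w measure \<Rightarrow> ('w \<Rightarrow> real^'l::finite) \<Rightarrow> (real^'l \<Rightarrow> complex^'nt::finite^'nr::finite) \<Rightarrow>
     'l \<Rightarrow> 'l \<Rightarrow> complex^'nt^'nt" where
  "mean_response_gram M eta G i j =
     prob_space.expectation M (\<lambda>w. response_gram G i j (eta w))"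

(* A beamforming matrix with N columns is the list of its N columns, so that N can be
   quantified over. With K users, columns 0, ..., K - 1 are the communication beamformers
   and the remaining columns are the sensing beamformers. *)
type_synonym 'nt beamformer = "(complex^'nt) list"

(* The matrix V V^H. *)
definition tx_cov :: "'nt::finite beamformer \<Rightarrow> complex^'nt^'nt" where
  "tx_cov V = (\<chi> a b. \<Sum>n<length V. (V ! n) $ a * cnj ((V ! n) $ b))"

(* The trace of V V^H is real, Re only changes the type. *)
definition tx_power :: "'nt::finite beamformer \<Rightarrow> real" where
  "tx_power V = Re (trace (tx_cov V))"

(* The mean response Gram matrices are Hermitian and V V^H is Hermitian, hence the trace of
   their product is real and Re only changes the type. *)
definition bfim ::
    "'w measure \<Rightarrow> ('w \<Rightarrow> real^'l::finite) \<Rightarrow> (real^'l \<Rightarrow> real) \<Rightarrow>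
     (real^'l \<Rightarrow> complex^'nt::finite^'nr::finite) \<Rightarrow> nat \<Rightarrow> real \<Rightarrow>
     'nt beamformer \<Rightarrow> real^'l^'l" where
  "bfim M eta f G Ups \<sigma> V =
     prior_information M eta f +
     (\<chi> i j. real Ups / \<sigma>\<^sup>2 * Re (trace (mean_response_gram M eta G i j ** tx_cov V)))"

(* a^H b *)
definition herm_prod :: "complex^'n::finite \<Rightarrow> complex^'n \<Rightarrow> complex" where
  "herm_prod a b = (\<Sum>n\<in>UNIV. cnj (a $ n) * b $ n)"

(* Interference cancellation removes the sensing columns from the denominator: only the
   communication columns of the other users remain. *)
definition sinr_ic :: "nat \<Rightarrow> (nat \<Rightarrow> complex^'nt::finite) \<Rightarrow> real \<Rightarrow> 'nt beamformer \<Rightarrow> nat \<Rightarrow> real" where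
  "sinr_ic K chan \<sigma> V k =
     (cmod (herm_prod (chan k) (V ! k)))\<^sup>2 /
     ((\<Sum>i\<in>{..<K} - {k}. (cmod (herm_prod (chan k) (V ! i)))\<^sup>2) + \<sigma>\<^sup>2)"

definition vsinr_ic :: "nat \<Rightarrow> (nat \<Rightarrow> complex^'nt::finite) \<Rightarrow> real \<Rightarrow> 'nt beamformer \<Rightarrow> real list" where
  "vsinr_ic K chan \<sigma> V = map (sinr_ic K chan \<sigma> V) [0..<K]"

definition achievable_ic ::
    "'w measure \<Rightarrow> ('w \<Rightarrow> real^'l::finite) \<Rightarrow> (real^'l \<Rightarrow> real) \<Rightarrow>
     (real^'l \<Rightarrow> complex^'nt::finite^'nr::finite) \<Rightarrow> nat \<Rightarrow> real \<Rightarrow>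
     nat \<Rightarrow> (nat \<Rightarrow> complex^'nt) \<Rightarrow> real \<Rightarrow> ((real^'l^'l) \<times> real list) set" where
  "achievable_ic M eta f G Ups \<sigma> K chan P =
     {(bfim M eta f G Ups \<sigma> V, vsinr_ic K chan \<sigma> V) | V.
        length V = CARD('nt) + K \<and> tx_power V \<le> P}"

definition feasible_ic ::
    "nat \<Rightarrow> (nat \<Rightarrow> complex^'nt::finite) \<Rightarrow> real \<Rightarrow> real \<Rightarrow> (nat \<Rightarrow> real) \<Rightarrow> nat \<Rightarrow>
     'nt beamformer set" where
  "feasible_ic K chan \<sigma> P gam N =
     {V. length V = N \<and> (\<forall>k<K. gam k \<le> sinr_ic K chan \<sigma> V k) \<and> tx_power V \<le> P}"

definition strictly_feasible_ic ::
    "nat \<Rightarrow> (nat \<Rightarrow> complex^'nt::finite) \<Rightarrow> real \<Rightarrow> real \<Rightarrow> (nat \<Rightarrow> real) \<Rightarrow> nat \<Rightarrow> bool" where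
  "strictly_feasible_ic K chan \<sigma> P gam N \<longleftrightarrow>
     (\<exists>V. length V = N \<and> (\<forall>k<K. gam k < sinr_ic K chan \<sigma> V k) \<and> tx_power V < P)"

(* The objective is defined only where the Fisher information matrix is invertible, so this is
   an implicit constraint. The value is an infimum in the extended reals. *)
definition opt_value_ic ::
    "'w measure \<Rightarrow> ('w \<Rightarrow> real^'l::finite) \<Rightarrow> (real^'l \<Rightarrow> real) \<Rightarrow>
     (real^'l \<Rightarrow> complex^'nt::finite^'nr::finite) \<Rightarrow> nat \<Rightarrow> real \<Rightarrow>
     nat \<Rightarrow> (nat \<Rightarrow> complex^'nt) \<Rightarrow> real \<Rightarrow>
     (real^'l^'l \<Rightarrow> real) \<Rightarrow> (nat \<Rightarrow> real) \<Rightarrow> nat \<Rightarrow> ereal" where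
  "opt_value_ic M eta f G Ups \<sigma> K chan P \<phi> gam N =
     (INF V \<in> {V \<in> feasible_ic K chan \<sigma> P gam N. invertible (bfim M eta f G Ups \<sigma> V)}.
        ereal (\<phi> (matrix_inv (bfim M eta f G Ups \<sigma> V))))"

definition N_min_ic ::
    "'w measure \<Rightarrow> ('w \<Rightarrow> real^'l::finite) \<Rightarrow> (real^'l \<Rightarrow> real) \<Rightarrow>
     (real^'l \<Rightarrow> complex^'nt::finite^'nr::finite) \<Rightarrow> nat \<Rightarrow> real \<Rightarrow>
     nat \<Rightarrow> (nat \<Rightarrow> complex^'nt) \<Rightarrow> real \<Rightarrow>
     (real^'l^'l \<Rightarrow> real) \<Rightarrow> (nat \<Rightarrow> real) \<Rightarrow> nat" where
  "N_min_ic M eta f G Ups \<sigma> K chan P \<phi> gam =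
     (LEAST N. K \<le> N \<and>
        opt_value_ic M eta f G Ups \<sigma> K chan P \<phi> gam N =
        opt_value_ic M eta f G Ups \<sigma> K chan P \<phi> gam (CARD('nt) + K))"

definition N_bound_ic :: "nat \<Rightarrow> nat \<Rightarrow> nat" where
  "N_bound_ic L K = nat \<lfloor>real K + sqrt (real L * (real L + 1) / 2)\<rfloor>"

end

theory Submission
  imports Defs
begin

text \<open>The communication beamformers are kept, so the SINRs do not change at all; only the \<open>m\<close> sensing
  beamformers \<open>w\<^sub>p\<close> are modified. If \<open>m\<^sup>2 > L (L + 1) / 2\<close>, a dimension count gives a nonzero
  Hermitian \<open>S\<close> such that adding a multiple of \<open>\<Sum> S\<^sub>p\<^sub>q w\<^sub>p w\<^sub>q\<^sup>H\<close> to the covariance leaves the Fisher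
  information unchanged. Up to sign this does not increase the power and \<open>S\<close> is not positive
  semidefinite. Moving along \<open>S\<close> until \<open>I + r S\<close> becomes singular and factoring that matrix with
  \<open>m - 1\<close> columns saves one beamformer. For the minimum number of beamformers, zero columns are
  used as padding.\<close>

section \<open>Hermitian forms on finite index sets and factorisation of the positive semidefinite
  ones\<close>

text \<open>The conjugate sits on the second index so that the diagonal entries of
  \<open>mix_cov I A w\<close> are values of this form. The index set is an explicit argument, which
  permits induction on it and deletion of single indices.\<close>

definition hform :: "'i set \<Rightarrow> ('i \<Rightarrow> 'i \<Rightarrow> complex) \<Rightarrow> ('i \<Rightarrow> complex) \<Rightarrow> complex" where
  "hform I A x = (\<Sum>p\<in>I. \<Sum>q\<in>I. A p q * x p * cnj (x q))"

definition hermitian_on :: "'i set \<Rightarrow> ('i \<Rightarrow> 'i \<Rightarrow> complex) \<Rightarrow> bool" where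
  "hermitian_on I A \<longleftrightarrow> (\<forall>p\<in>I. \<forall>q\<in>I. A q p = cnj (A p q))"

definition psd_on :: "'i set \<Rightarrow> ('i \<Rightarrow> 'i \<Rightarrow> complex) \<Rightarrow> bool" where
  "psd_on I A \<longleftrightarrow> hermitian_on I A \<and> (\<forall>x. 0 \<le> Re (hform I A x))"

lemma hform_cong:
  "(\<And>p. p \<in> I \<Longrightarrow> x p = y p) \<Longrightarrow> hform I A x = hform I A y"
  by (simp add: hform_def)

text \<open>Separates the variable \<open>x a\<close>, with a view to completing the square in it.
  The two cross terms are conjugates of each other by Hermitian symmetry.\<close>

lemma hform_insert:
  assumes "finite I" "a \<notin> I" "hermitian_on (insert a I) A"
  shows "hform (insert a I) A x =
    A a a * x a * cnj (x a) + (\<Sum>p\<in>I. A p a * x p) * cnj (x a)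
      + cnj (\<Sum>p\<in>I. A p a * x p) * x a + hform I A x"
proof -
  have "A a q = cnj (A q a)" if "q \<in> I" for q
    using assms(3) that unfolding hermitian_on_def by blast
  then have row: "(\<Sum>q\<in>I. A a q * x a * cnj (x q)) = cnj (\<Sum>p\<in>I. A p a * x p) * x a"
    by (simp add: sum_distrib_left sum_distrib_right mult_ac)
  have "hform (insert a I) A x = A a a * x a * cnj (x a) + (\<Sum>q\<in>I. A a q * x a * cnj (x q))
      + ((\<Sum>p\<in>I. A p a * x p * cnj (x a)) + hform I A x)"
    using assms(1,2) by (simp add: hform_def sum.distrib)
  then show ?thesis
    unfolding row sum_distrib_right[symmetric] by (simp only: ac_simps)
qed

lemma hermitian_on_subset: "hermitian_on I A \<Longrightarrow> J \<subseteq> I \<Longrightarrow> hermitian_on J A"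
  by (auto simp: hermitian_on_def)

lemma psd_on_subset:
  assumes "finite I" "psd_on I A" "J \<subseteq> I"
  shows "psd_on J A"
proof -
  \<comment> \<open>Vectors on \<open>J\<close> are extended by zero to \<open>I\<close>; the form
    does not see the difference.\<close>
  have "hform J A x = hform I A (\<lambda>p. if p \<in> J then x p else 0)" for x
  proof -
    have "hform I A (\<lambda>p. if p \<in> J then x p else 0)
        = (\<Sum>p\<in>J. \<Sum>q\<in>I. A p q * x p * cnj (if q \<in> J then x q else 0))"
      unfolding hform_def using assms by (intro sum.mono_neutral_cong_right) auto
    also have "\<dots> = hform J A x"
      unfolding hform_def using assms
      by (intro sum.cong refl sum.mono_neutral_cong_right) auto
    finally show ?thesis by simp
  qed
  then show ?thesis
    using assms by (auto simp: psd_on_def intro: hermitian_on_subset)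
qed

lemma hermitian_diag_real:
  assumes "hermitian_on I A" "a \<in> I"
  shows "A a a = complex_of_real (Re (A a a))"
proof -
  have "cnj (A a a) = A a a"
    using assms by (metis hermitian_on_def)
  then show ?thesis by (simp add: complex_eq_iff)
qed

lemma psd_on_diag_nonneg:
  assumes "finite I" "psd_on I A" "a \<in> I"
  shows "0 \<le> Re (A a a)"
proof -
  have "psd_on {a} A" using psd_on_subset[OF assms(1,2)] assms(3) by simp
  then have "0 \<le> Re (hform {a} A (\<lambda>_. 1))" unfolding psd_on_def by blast
  then show ?thesis by (simp add: hform_def)
qed

text \<open>With the coordinate at \<open>p\<close> fixed to 1, the form on the two indices
  \<open>a\<close> and \<open>p\<close> is affine in the coordinate at \<open>a\<close>, because the
  quadratic coefficient \<open>A a a\<close> vanishes. Boundedness below then forces the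
  off-diagonal entry to be zero.\<close>

lemma psd_on_zero_diag:
  assumes "finite I" "psd_on I A" "a \<in> I" "p \<in> I" "A a a = 0"
  shows "A p a = 0"
proof (cases "p = a")
  case False
  have psd: "psd_on (insert a {p}) A"
    using psd_on_subset[OF assms(1,2)] assms(3,4) by simp
  define z where "z = A p a"
  have "0 \<le> Re (A p p) - 2 * r * (cmod z)\<^sup>2" for r
  proof -
    have "0 \<le> Re (hform (insert a {p}) A (\<lambda>q. if q = a then - of_real r * z else 1))"
      using psd by (auto simp: psd_on_def)
    also have "\<dots> = Re (A p p) - 2 * r * (cmod z)\<^sup>2"
      using False psd assms(5)
      by (subst hform_insert)
         (auto simp: psd_on_def hform_def z_def[symmetric] cmod_power2 power2_eq_square[of "Re z"]
           power2_eq_square[of "Im z"] algebra_simps)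
    finally show ?thesis .
  qed
  \<comment> \<open>This \<open>r\<close> would make the right-hand side equal to -1 if
    \<open>z\<close> were nonzero.\<close>
  note this[of "(Re (A p p) + 1) / (2 * (cmod z)\<^sup>2)"]
  then have "z = 0" by (cases "z = 0") (auto simp: field_simps)
  then show ?thesis by (simp add: z_def)
qed (use assms in simp)

text \<open>Cholesky factorisation by induction on the index set: the pivot \<open>a\<close> is
  split off and the Schur complement on the remaining indices is factored. The factors are indexed
  by \<open>I\<close> itself, so there are \<open>card I\<close> of them.\<close>

lemma psd_on_factor:
  assumes "finite I" "psd_on I A"
  shows "\<exists>b. \<forall>p\<in>I. \<forall>q\<in>I. A p q = (\<Sum>j\<in>I. b j p * cnj (b j q))"
  using assms
proof (induction I arbitrary: A rule: finite_induct)
  case empty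
  then show ?case by simp
next
  case (insert a I)
  have herm: "A q p = cnj (A p q)" if "p \<in> insert a I" "q \<in> insert a I" for p q
    using insert.prems that unfolding psd_on_def hermitian_on_def by blast
  define d where "d = Re (A a a)"
  have Aaa: "A a a = of_real d"
    using insert.prems hermitian_diag_real[of "insert a I" A a] by (simp add: psd_on_def d_def)
  have "d \<ge> 0" using psd_on_diag_nonneg[OF _ insert.prems, of a] insert.hyps by (simp add: d_def)
  show ?case
  proof (cases "d = 0")
    case True
    \<comment> \<open>A zero pivot kills its row and column, so the factors of the rest are extended
      by zero.\<close>
    obtain b where b: "\<forall>p\<in>I. \<forall>q\<in>I. A p q = (\<Sum>j\<in>I. b j p * cnj (b j q))"
      using insert.IH[of A] psd_on_subset[OF _ insert.prems, of I] insert.hyps by blast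
    have col: "A p a = 0" if "p \<in> insert a I" for p
      using psd_on_zero_diag[OF _ insert.prems _ that] insert.hyps Aaa True by simp
    have row: "A a p = 0" if "p \<in> insert a I" for p
      using herm[of p a] col that by simp
    let ?b = "\<lambda>j p. if j = a \<or> p = a then 0 else b j p"
    have "A p q = (\<Sum>j\<in>insert a I. ?b j p * cnj (?b j q))"
      if "p \<in> insert a I" "q \<in> insert a I" for p q
    proof (cases "p = a \<or> q = a")
      case True
      then show ?thesis using row col that by auto
    next
      case False
      then have "(\<Sum>j\<in>I. ?b j p * cnj (?b j q)) = (\<Sum>j\<in>I. b j p * cnj (b j q))"
        using insert.hyps by (intro sum.cong) auto
      then show ?thesis using False that b insert.hyps by simp
    qed
    then show ?thesis by (intro exI[of _ ?b]) simp
  next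
    case False
    with \<open>d \<ge> 0\<close> have "d > 0" by simp
    \<comment> \<open>The Schur complement of the pivot \<open>d\<close>.\<close>
    define A' where "A' = (\<lambda>p q. A p q - A p a * A a q / of_real d)"
    have "psd_on I A'"
      unfolding psd_on_def
    proof (intro conjI allI)
      show "hermitian_on I A'"
        unfolding hermitian_on_def A'_def
      proof (intro ballI)
        fix p q assume "p \<in> I" "q \<in> I"
        then show "A q p - A q a * A a p / of_real d = cnj (A p q - A p a * A a q / of_real d)"
          using herm[of p q] herm[of a p] herm[of q a] by simp
      qed
    next
      fix x
      define c where "c = (\<Sum>p\<in>I. A p a * x p)"
      have "cnj c = (\<Sum>q\<in>I. A a q * cnj (x q))"
        unfolding c_def cnj_sum
      proof (intro sum.cong refl)
        fix q assume "q \<in> I"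
        then show "cnj (A q a * x q) = A a q * cnj (x q)" using herm[of q a] by simp
      qed
      then have "hform I A' x = hform I A x - c * cnj c / of_real d"
      proof -
        assume cnj_c: "cnj c = (\<Sum>q\<in>I. A a q * cnj (x q))"
        have "hform I A' x = (\<Sum>p\<in>I. \<Sum>q\<in>I. A p q * x p * cnj (x q)
            - (A p a * x p) * (A a q * cnj (x q)) / of_real d)"
          unfolding hform_def A'_def by (intro sum.cong refl) (simp add: algebra_simps)
        also have "\<dots> = hform I A x - (\<Sum>p\<in>I. \<Sum>q\<in>I. (A p a * x p) * (A a q * cnj (x q))) / of_real d"
          unfolding hform_def by (simp only: sum_subtractf sum_divide_distrib)
        also have "(\<Sum>p\<in>I. \<Sum>q\<in>I. (A p a * x p) * (A a q * cnj (x q))) = c * cnj c"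
          unfolding cnj_c unfolding c_def by (rule sum_product[symmetric])
        finally show ?thesis .
      qed
      \<comment> \<open>The coordinate \<open>- c / d\<close> at \<open>a\<close> completes the
        square in \<open>hform_insert\<close>. The form of \<open>A'\<close> is thus a value of the
        form of \<open>A\<close>, hence nonnegative.\<close>
      moreover have "hform (insert a I) A (x(a := - c / of_real d))
          = hform I A x - c * cnj c / of_real d"
      proof -
        have "(\<Sum>p\<in>I. A p a * (x(a := - c / of_real d)) p) = c"
          unfolding c_def using insert.hyps by (intro sum.cong) auto
        moreover have "hform I A (x(a := - c / of_real d)) = hform I A x"
          using insert.hyps by (intro hform_cong) auto
        ultimately show ?thesis
          using insert.prems insert.hyps \<open>d > 0\<close> Aaa
          by (subst hform_insert) (auto simp: psd_on_def field_simps)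
      qed
      ultimately show "0 \<le> Re (hform I A' x)"
        using insert.prems by (metis psd_on_def)
    qed
    then obtain b where b: "\<forall>p\<in>I. \<forall>q\<in>I. A' p q = (\<Sum>j\<in>I. b j p * cnj (b j q))"
      using insert.IH by blast
    \<comment> \<open>The new factor is the pivot column divided by \<open>sqrt d\<close>; it
      carries the rank-one term removed in \<open>A'\<close>. The old factors vanish at
      \<open>a\<close>.\<close>
    let ?b = "\<lambda>j p. if j = a then A p a / of_real (sqrt d) else if p = a then 0 else b j p"
    have sq: "complex_of_real (sqrt d) * complex_of_real (sqrt d) = of_real d"
      using \<open>d > 0\<close> by (simp flip: of_real_mult)
    have "A p q = (\<Sum>j\<in>insert a I. ?b j p * cnj (?b j q))"
      if pq: "p \<in> insert a I" "q \<in> insert a I" for p q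
    proof -
      have split: "(\<Sum>j\<in>insert a I. ?b j p * cnj (?b j q)) =
          A p a * A a q / of_real d + (\<Sum>j\<in>I. ?b j p * cnj (?b j q))"
        using insert.hyps herm[of q a] pq sq by simp
      show ?thesis
      proof (cases "p = a \<or> q = a")
        case True
        then have "(\<Sum>j\<in>I. ?b j p * cnj (?b j q)) = 0"
          using insert.hyps by (intro sum.neutral) auto
        with split True Aaa \<open>d > 0\<close> show ?thesis by auto
      next
        case False
        then have "(\<Sum>j\<in>I. ?b j p * cnj (?b j q)) = (\<Sum>j\<in>I. b j p * cnj (b j q))"
          using insert.hyps by (intro sum.cong) auto
        also have "\<dots> = A' p q" using b False pq by simp
        finally show ?thesis unfolding split by (simp add: A'_def)
      qed
    qed
    then show ?thesis by (intro exI[of _ ?b]) simp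
  qed
qed

lemma hform_factor:
  assumes "\<forall>p\<in>I. \<forall>q\<in>I. A p q = (\<Sum>j\<in>J. b j p * cnj (b j q))"
  shows "hform I A x = (\<Sum>j\<in>J. of_real ((cmod (\<Sum>p\<in>I. b j p * x p))\<^sup>2))"
proof -
  have "hform I A x = (\<Sum>p\<in>I. \<Sum>q\<in>I. \<Sum>j\<in>J. (b j p * x p) * cnj (b j q * x q))"
    unfolding hform_def
    by (intro sum.cong refl) (simp add: assms sum_distrib_left sum_distrib_right mult_ac)
  also have "\<dots> = (\<Sum>p\<in>I. \<Sum>j\<in>J. \<Sum>q\<in>I. (b j p * x p) * cnj (b j q * x q))"
    by (intro sum.cong refl sum.swap)
  also have "\<dots> = (\<Sum>j\<in>J. \<Sum>p\<in>I. \<Sum>q\<in>I. (b j p * x p) * cnj (b j q * x q))"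
    by (rule sum.swap)
  also have "\<dots> = (\<Sum>j\<in>J. (\<Sum>p\<in>I. b j p * x p) * cnj (\<Sum>p\<in>I. b j p * x p))"
    by (simp add: sum_product cnj_sum)
  finally show ?thesis by (simp only: complex_norm_square)
qed

text \<open>The factorisation makes the form a sum of squared moduli of linear forms. Its vanishing
  at \<open>u\<close> forces each linear form to vanish at \<open>u\<close>, and the claimed sum is
  a combination of these.\<close>

lemma psd_on_kernel:
  assumes "finite I" "psd_on I A" "hform I A u = 0" "q \<in> I"
  shows "(\<Sum>p\<in>I. A p q * u p) = 0"
proof -
  obtain b where b: "\<forall>p\<in>I. \<forall>q\<in>I. A p q = (\<Sum>j\<in>I. b j p * cnj (b j q))"
    using psd_on_factor[OF assms(1,2)] by blast
  have "complex_of_real (\<Sum>j\<in>I. (cmod (\<Sum>p\<in>I. b j p * u p))\<^sup>2) = 0"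
    using hform_factor[OF b, of u] assms(3) by simp
  then have "(\<Sum>j\<in>I. (cmod (\<Sum>p\<in>I. b j p * u p))\<^sup>2) = 0"
    unfolding of_real_eq_0_iff .
  then have z: "(\<Sum>p\<in>I. b j p * u p) = 0" if "j \<in> I" for j
    using that assms(1) by (subst (asm) sum_nonneg_eq_0_iff) auto
  have "(\<Sum>p\<in>I. A p q * u p) = (\<Sum>p\<in>I. \<Sum>j\<in>I. cnj (b j q) * (b j p * u p))"
    using b assms(4) by (simp add: sum_distrib_left sum_distrib_right mult_ac)
  also have "\<dots> = (\<Sum>j\<in>I. cnj (b j q) * (\<Sum>p\<in>I. b j p * u p))"
    by (subst sum.swap) (simp add: sum_distrib_left)
  also have "\<dots> = 0" using z by simp
  finally show ?thesis .
qed

text \<open>A singular matrix needs one factor fewer. The kernel vector \<open>u\<close> expresses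
  row \<open>a\<close> through the other rows, so a factorisation of the minor on
  \<open>I - {a}\<close> extends to \<open>a\<close> by the same linear combination.\<close>

lemma singular_psd_on_factor:
  assumes "finite I" "psd_on I A" "hform I A u = 0" "a \<in> I" "u a \<noteq> 0"
  shows "\<exists>b. \<forall>p\<in>I. \<forall>q\<in>I. A p q = (\<Sum>j\<in>I - {a}. b j p * cnj (b j q))"
proof -
  let ?J = "I - {a}"
  have herm: "A q p = cnj (A p q)" if "p \<in> I" "q \<in> I" for p q
    using assms(2) that unfolding psd_on_def hermitian_on_def by blast
  obtain b where b: "\<forall>p\<in>?J. \<forall>q\<in>?J. A p q = (\<Sum>j\<in>?J. b j p * cnj (b j q))"
    using psd_on_factor[of ?J A] psd_on_subset[OF assms(1,2), of ?J] assms(1) by auto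
  define c where "c = (\<lambda>p. - u p / u a)"
  have row: "A a q = (\<Sum>p\<in>?J. c p * A p q)" if "q \<in> I" for q
  proof -
    have "A a q * u a + (\<Sum>p\<in>?J. A p q * u p) = 0"
      using psd_on_kernel[OF assms(1-3) that] assms(1,4) by (simp add: sum.remove)
    then have "A a q = - (\<Sum>p\<in>?J. A p q * u p) / u a"
      using assms(5) by (simp add: field_simps add_eq_0_iff)
    also have "\<dots> = (\<Sum>p\<in>?J. c p * A p q)"
      by (simp add: c_def sum_divide_distrib sum_negf mult_ac)
    finally show ?thesis .
  qed
  define b' where "b' = (\<lambda>j p. if p = a then (\<Sum>p\<in>?J. c p * b j p) else b j p)"
  have base: "A p q = (\<Sum>j\<in>?J. b' j p * cnj (b' j q))" if "p \<in> ?J" "q \<in> ?J" for p q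
    using b that by (auto simp: b'_def)
  have ext: "A a q = (\<Sum>j\<in>?J. b' j a * cnj (b' j q))"
    if "q \<in> I" "\<And>p. p \<in> ?J \<Longrightarrow> A p q = (\<Sum>j\<in>?J. b' j p * cnj (b' j q))" for q
  proof -
    have "A a q = (\<Sum>p\<in>?J. \<Sum>j\<in>?J. c p * b j p * cnj (b' j q))"
      unfolding row[OF that(1)] using that(2)
      by (intro sum.cong refl) (auto simp: b'_def sum_distrib_left mult_ac)
    also have "\<dots> = (\<Sum>j\<in>?J. b' j a * cnj (b' j q))"
      by (subst sum.swap) (simp add: b'_def sum_distrib_right)
    finally show ?thesis .
  qed
  have row': "A a q = (\<Sum>j\<in>?J. b' j a * cnj (b' j q))" if "q \<in> ?J" for q
    using ext base that by auto
  have col': "A q a = (\<Sum>j\<in>?J. b' j q * cnj (b' j a))" if "q \<in> ?J" for q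
    using herm[of a q] row'[OF that] that assms(4) by (simp add: cnj_sum mult.commute)
  \<comment> \<open>At \<open>q = a\<close> the hypothesis of \<open>ext\<close> is
    \<open>col'\<close>, obtained from \<open>row'\<close> by Hermitian symmetry.\<close>
  have diag: "A a a = (\<Sum>j\<in>?J. b' j a * cnj (b' j a))"
    using ext[OF assms(4)] col' by blast
  have "A p q = (\<Sum>j\<in>?J. b' j p * cnj (b' j q))" if "p \<in> I" "q \<in> I" for p q
    by (cases "p = a"; cases "q = a")
       (use diag row' col' base that in \<open>simp_all del: cnj_sum\<close>)
  then show ?thesis by blast
qed

section \<open>Counting: underdetermined linear systems and symmetric families\<close>

text \<open>Gaussian elimination by induction on the equations: a pivot \<open>e\<close> of equation
  \<open>k\<close> is eliminated from the other equations, and its value is recovered afterwards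
  from equation \<open>k\<close>.\<close>

lemma underdetermined_system:
  fixes a :: "'j \<Rightarrow> 'i \<Rightarrow> 'a::field"
  assumes "finite J" "finite I" "card J < card I"
  shows "\<exists>x. (\<exists>i\<in>I. x i \<noteq> 0) \<and> (\<forall>j\<in>J. (\<Sum>i\<in>I. a j i * x i) = 0)"
  using assms
proof (induction J arbitrary: I a rule: finite_induct)
  case empty
  then obtain i where "i \<in> I" by (metis card.empty card_gt_0_iff ex_in_conv)
  then show ?case by (intro exI[of _ "\<lambda>_. 1"]) auto
next
  case (insert k J)
  show ?case
  proof (cases "\<forall>i\<in>I. a k i = 0")
    case True
    then show ?thesis using insert.IH[of I a] insert.prems insert.hyps by auto
  next
    case False
    then obtain e where e: "e \<in> I" "a k e \<noteq> 0" by blast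
    have "card J < card (I - {e})" using insert.prems insert.hyps e by auto
    then obtain x where x: "\<exists>i\<in>I - {e}. x i \<noteq> 0"
      "\<forall>j\<in>J. (\<Sum>i\<in>I - {e}. (a j i - a j e / a k e * a k i) * x i) = 0"
      using insert.IH[of "I - {e}" "\<lambda>j i. a j i - a j e / a k e * a k i"] insert.prems by auto
    let ?s = "\<lambda>j. \<Sum>i\<in>I - {e}. a j i * x i"
    let ?x = "x(e := - ?s k / a k e)"
    \<comment> \<open>For \<open>j = k\<close> the right-hand side is zero; for \<open>j\<close> in
      \<open>J\<close> it is the equation after elimination.\<close>
    have sum: "(\<Sum>i\<in>I. a j i * ?x i) = ?s j - a j e / a k e * ?s k" for j
    proof -
      have "(\<Sum>i\<in>I. a j i * ?x i) = a j e * ?x e + (\<Sum>i\<in>I - {e}. a j i * ?x i)"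
        using e insert.prems by (simp add: sum.remove)
      also have "(\<Sum>i\<in>I - {e}. a j i * ?x i) = ?s j" by (intro sum.cong) auto
      finally show ?thesis by simp
    qed
    have "?s j - a j e / a k e * ?s k = 0" if "j \<in> J" for j
      using x(2) that
      by (simp add: left_diff_distrib sum_subtractf sum_distrib_left mult.assoc)
    then have "\<forall>j\<in>insert k J. (\<Sum>i\<in>I. a j i * ?x i) = 0"
      unfolding sum using e by auto
    moreover have "\<exists>i\<in>I. ?x i \<noteq> 0" using x(1) by auto
    ultimately show ?thesis by blast
  qed
qed

text \<open>A symmetric family factors through the unordered pairs \<open>{i, j}\<close>, which are
  the subsets of size 1 or 2. With \<open>L = CARD('l)\<close> there are
  \<open>L + L (L - 1) / 2\<close> of them.\<close>

lemma card_symmetric_family_le: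
  fixes \<Phi> :: "'l::finite \<Rightarrow> 'l \<Rightarrow> 'b"
  assumes "\<And>i j. \<Phi> i j = \<Phi> j i"
  shows "2 * card (range (\<lambda>(i, j). \<Phi> i j)) \<le> CARD('l) * (CARD('l) + 1)"
proof -
  define U where "U = {B::'l set. B \<subseteq> UNIV \<and> card B = 1} \<union> {B. B \<subseteq> UNIV \<and> card B = 2}"
  \<comment> \<open>By symmetry the value does not depend on which ordering of \<open>B\<close> is
    chosen.\<close>
  define g where "g = (\<lambda>B. SOME z. \<exists>i j. B = {i, j} \<and> z = \<Phi> i j)"
  have g: "g {i, j} = \<Phi> i j" for i j
  proof -
    have "\<exists>i' j'. {i, j} = {i', j'} \<and> g {i, j} = \<Phi> i' j'"
      unfolding g_def by (rule someI_ex) blast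
    then show ?thesis using assms by (auto simp: doubleton_eq_iff)
  qed
  have "range (\<lambda>(i, j). \<Phi> i j) \<subseteq> g ` U"
  proof clarify
    fix i j
    have "{i, j} \<in> U" by (cases "i = j") (auto simp: U_def)
    then show "\<Phi> i j \<in> g ` U" using g by (metis imageI)
  qed
  then have "card (range (\<lambda>(i, j). \<Phi> i j)) \<le> card U"
    by (meson card_image_le card_mono finite finite_imageI le_trans)
  also have "card U \<le> CARD('l) + (CARD('l) choose 2)"
    unfolding U_def using n_subsets[of "UNIV :: 'l set" 1] n_subsets[of "UNIV :: 'l set" 2]
    by (intro order.trans[OF card_Un_le]) simp
  also have "2 * \<dots> = CARD('l) * (CARD('l) + 1)"
    using choose_two[of "CARD('l)"] by (cases "CARD('l)") auto
  finally show ?thesis by simp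
qed

section \<open>Minimum of a form over the unit sphere\<close>

text \<open>The vector \<open>u\<close> minimises the Rayleigh quotient; for Hermitian
  \<open>S\<close> it is a unit eigenvector of the smallest eigenvalue. The minimum exists by
  compactness of the sphere, and homogeneity carries the bound from unit vectors to all
  \<open>x\<close>.\<close>

lemma hform_attains_min:
  fixes S :: "nat \<Rightarrow> nat \<Rightarrow> complex"
  assumes "m > 0"
  shows "\<exists>u. (\<Sum>p<m. (cmod (u p))\<^sup>2) = 1 \<and>
    (\<forall>x. Re (hform {..<m} S u) * (\<Sum>p<m. (cmod (x p))\<^sup>2) \<le> Re (hform {..<m} S x))"
proof -
  \<comment> \<open>Coordinates from \<open>m\<close> on are fixed to 0, so that this product of
    compact sets is compact in the product topology on functions. The unit sphere is cut out of it
    by the closed condition \<open>N x = 1\<close>.\<close>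
  define B :: "(nat \<Rightarrow> complex) set" where "B = (\<Pi>\<^sub>E p\<in>UNIV. if p < m then cball 0 1 else {0})"
  define N :: "(nat \<Rightarrow> complex) \<Rightarrow> real" where "N = (\<lambda>x. \<Sum>p<m. (cmod (x p))\<^sup>2)"
  have "compact B"
    unfolding B_def compactin_euclidean_iff[symmetric] euclidean_product_topology[symmetric]
    by (subst compactin_PiE) auto
  have contN: "continuous_on UNIV N"
    unfolding N_def by (intro continuous_intros continuous_on_product_coordinates)
  have "closed (N -` {1})"
    using contN by (simp add: continuous_on_closed_vimage)
  then have "compact (B \<inter> N -` {1})"
    by (rule compact_Int_closed[OF \<open>compact B\<close>])
  \<comment> \<open>The first unit vector shows that the sphere is nonempty; here
    \<open>m > 0\<close> enters.\<close>
  moreover have "(\<lambda>p. if p = 0 then 1 else 0) \<in> B \<inter> N -` {1}"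
  proof -
    have "N (\<lambda>p. if p = 0 then 1 else 0) = (\<Sum>p<m. if p = 0 then 1 else 0)"
      unfolding N_def by (intro sum.cong) auto
    with assms show ?thesis by (auto simp: B_def)
  qed
  moreover have "continuous_on (B \<inter> N -` {1}) (\<lambda>x. Re (hform {..<m} S x))"
    unfolding hform_def
    by (intro continuous_intros continuous_on_subset[OF continuous_on_product_coordinates]) auto
  ultimately obtain u where u: "u \<in> B" "N u = 1"
    and min: "\<And>x. x \<in> B \<Longrightarrow> N x = 1 \<Longrightarrow> Re (hform {..<m} S u) \<le> Re (hform {..<m} S x)"
    using continuous_attains_inf[of "B \<inter> N -` {1}" "\<lambda>x. Re (hform {..<m} S x)"] by fast
  have "Re (hform {..<m} S u) * N x \<le> Re (hform {..<m} S x)" for x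
  proof (cases "N x = 0")
    case True
    then have "x p = 0" if "p < m" for p
      using that unfolding N_def by (subst (asm) sum_nonneg_eq_0_iff) auto
    then have "hform {..<m} S x = 0" by (simp add: hform_def)
    with True show ?thesis by simp
  next
    case False
    define s where "s = sqrt (N x)"
    have "N x \<ge> 0" by (simp add: N_def sum_nonneg)
    with False have s: "s > 0" "s\<^sup>2 = N x" by (auto simp: s_def)
    \<comment> \<open>Normalised to length 1 and cut off from \<open>m\<close> on, in order to lie
      in \<open>B\<close>.\<close>
    define y where "y = (\<lambda>p. if p < m then x p / of_real s else 0)"
    have "N y = (\<Sum>p<m. (cmod (x p))\<^sup>2 / s\<^sup>2)"
      unfolding N_def using s(1)
      by (intro sum.cong refl) (auto simp: y_def norm_divide power_divide)
    also have "\<dots> = 1"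
      using False s(2) by (simp add: N_def flip: sum_divide_distrib)
    finally have Ny: "N y = 1" .
    have "y \<in> B"
    proof -
      have "cmod (y p) \<le> 1" for p
      proof (cases "p < m")
        case True
        then have "(cmod (y p))\<^sup>2 \<le> N y"
          unfolding N_def by (intro member_le_sum) auto
        then have "(cmod (y p))\<^sup>2 \<le> 1\<^sup>2" using Ny by simp
        then show ?thesis by (rule power2_le_imp_le) simp
      qed (simp add: y_def)
      moreover have "y p = 0" if "\<not> p < m" for p using that by (simp add: y_def)
      ultimately show ?thesis by (auto simp: B_def)
    qed
    have "hform {..<m} S x = of_real (s\<^sup>2) * hform {..<m} S y"
      using s(1) by (simp add: hform_def y_def sum_distrib_left power2_eq_square)
    then have "Re (hform {..<m} S x) = N x * Re (hform {..<m} S y)"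
      using s(2) by simp
    with min[OF \<open>y \<in> B\<close> Ny] \<open>N x \<ge> 0\<close> show ?thesis
      by (simp add: mult.commute mult_left_mono)
  qed
  with u show ?thesis unfolding N_def by blast
qed

section \<open>Covariance matrices of mixed beamformers\<close>

definition outer :: "complex^'n \<Rightarrow> complex^'n \<Rightarrow> complex^'n^'n" where
  "outer v w = (\<chi> a b. v $ a * cnj (w $ b))"

text \<open>This is \<open>W A W^H\<close>, where \<open>W\<close> has the columns
  \<open>w p\<close>. For the identity \<open>A\<close> it is the covariance of these
  columns.\<close>

definition mix_cov :: "'i set \<Rightarrow> ('i \<Rightarrow> 'i \<Rightarrow> complex) \<Rightarrow> ('i \<Rightarrow> complex^'n) \<Rightarrow> complex^'n^'n" where
  "mix_cov I A w = (\<chi> a b. \<Sum>p\<in>I. \<Sum>q\<in>I. A p q * w p $ a * cnj (w q $ b))"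

lemma tx_cov_conv_sum_list: "tx_cov V = (\<Sum>v\<leftarrow>V. outer v v)"
proof -
  have "(\<Sum>v\<leftarrow>V. outer v v) $ a $ b = tx_cov V $ a $ b" for a b
  proof -
    have "(\<Sum>v\<leftarrow>V. outer v v) $ a $ b = (\<Sum>v\<leftarrow>V. v $ a * cnj (v $ b))"
      by (induction V) (auto simp: outer_def)
    then show ?thesis
      by (simp add: tx_cov_def sum_list_sum_nth atLeast0LessThan)
  qed
  then show ?thesis by (simp add: vec_eq_iff)
qed

lemma tx_cov_append: "tx_cov (V @ W) = tx_cov V + tx_cov W"
  by (simp add: tx_cov_conv_sum_list)

lemma tx_cov_replicate_0: "tx_cov (replicate n 0) = 0"
  by (simp add: tx_cov_def vec_eq_iff)

lemma re_trace_mix_cov: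
  "Re (trace (mix_cov I A w)) = (\<Sum>a\<in>UNIV. Re (hform I A (\<lambda>p. w p $ a)))"
  by (simp add: trace_def mix_cov_def hform_def)

lemma mix_cov_scale:
  "mix_cov I (\<lambda>p q. of_real r * A p q) w = r *\<^sub>R mix_cov I A w"
  by (simp add: mix_cov_def vec_eq_iff sum_distrib_left scaleR_conv_of_real[where 'a=complex] mult_ac)

lemma mix_cov_add:
  "mix_cov I (\<lambda>p q. A p q + B p q) w = mix_cov I A w + mix_cov I B w"
  by (simp add: mix_cov_def vec_eq_iff sum.distrib algebra_simps)

lemma tx_cov_eq_mix_cov:
  "tx_cov V = mix_cov {..<length V} (\<lambda>p q. if p = q then 1 else 0) (\<lambda>p. V ! p)"
  by (simp add: tx_cov_def mix_cov_def vec_eq_iff if_distrib if_distribR cong: if_cong)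

text \<open>If \<open>A = B B^H\<close>, then \<open>W A W^H = (W B) (W B)^H\<close>: the columns of
  \<open>W B\<close> realise the covariance, with one beamformer per factor.\<close>

lemma mix_cov_factor:
  assumes "finite J" "\<forall>p\<in>I. \<forall>q\<in>I. A p q = (\<Sum>j\<in>J. b j p * cnj (b j q))"
  shows "\<exists>W. length W = card J \<and> tx_cov W = mix_cov I A w"
proof -
  obtain js where js: "set js = J" "distinct js" "length js = card J"
    using assms(1) finite_distinct_list distinct_card by metis
  define u where "u = (\<lambda>j. \<Sum>p\<in>I. b j p *s w p)"
  have "tx_cov (map u js) = (\<Sum>j\<in>J. outer (u j) (u j))"
    using js by (simp add: tx_cov_conv_sum_list comp_def sum_list_distinct_conv_sum_set)
  also have "\<dots> = mix_cov I A w"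
  proof -
    have "(\<Sum>j\<in>J. outer (u j) (u j)) $ a $ c = mix_cov I A w $ a $ c" for a c
    proof -
      have "(\<Sum>j\<in>J. outer (u j) (u j)) $ a $ c
          = (\<Sum>j\<in>J. (\<Sum>p\<in>I. b j p * w p $ a) * (\<Sum>q\<in>I. cnj (b j q * w q $ c)))"
        by (simp add: outer_def u_def)
      also have "\<dots> = (\<Sum>j\<in>J. \<Sum>p\<in>I. \<Sum>q\<in>I. (b j p * w p $ a) * cnj (b j q * w q $ c))"
        by (simp only: sum_product)
      also have "\<dots> = (\<Sum>p\<in>I. \<Sum>j\<in>J. \<Sum>q\<in>I. (b j p * w p $ a) * cnj (b j q * w q $ c))"
        by (rule sum.swap)
      also have "\<dots> = (\<Sum>p\<in>I. \<Sum>q\<in>I. \<Sum>j\<in>J. (b j p * w p $ a) * cnj (b j q * w q $ c))"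
        by (intro sum.cong refl sum.swap)
      also have "\<dots> = (\<Sum>p\<in>I. \<Sum>q\<in>I. A p q * w p $ a * cnj (w q $ c))"
        using assms(2) by (intro sum.cong refl) (simp add: sum_distrib_left sum_distrib_right mult_ac)
      finally show ?thesis by (simp add: mix_cov_def)
    qed
    then show ?thesis by (simp add: vec_eq_iff)
  qed
  finally show ?thesis using js by (intro exI[of _ "map u js"]) simp
qed

section \<open>Perturbing the covariance to save sensing beamformers\<close>

text \<open>With both signs semidefinite the diagonal vanishes, and with it every column. Hence a
  nonzero Hermitian matrix has at least one sign that is not positive semidefinite.\<close>

lemma psd_on_antisym:
  assumes "finite I" "psd_on I S" "psd_on I (\<lambda>p q. - S p q)" "p \<in> I" "q \<in> I"
  shows "S p q = 0"
proof -
  have "Re (S q q) = 0"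
    using psd_on_diag_nonneg[OF assms(1,2,5)] psd_on_diag_nonneg[OF assms(1,3,5)] by simp
  then have "S q q = 0"
    using hermitian_diag_real[of I S q] assms(2,5) by (simp add: psd_on_def)
  then show ?thesis using psd_on_zero_diag[OF assms(1,2,5,4)] by simp
qed

lemma hform_uminus: "hform I (\<lambda>p q. - S p q) x = - hform I S x"
  by (simp add: hform_def sum_negf)

lemma hermitian_on_uminus: "hermitian_on I S \<Longrightarrow> hermitian_on I (\<lambda>p q. - S p q)"
  unfolding hermitian_on_def by (metis complex_cnj_minus)

text \<open>Hermitian matrices are parametrised linearly by real matrices of the same size, so they form
  a real space of dimension \<open>(card I)\<^sup>2\<close>.\<close>

lemma exists_hermitian_annihilated:
  fixes w :: "'i \<Rightarrow> complex^'n::finite"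
    and \<Phi> :: "(complex^'n^'n \<Rightarrow> real) set"
  assumes "finite I" "finite \<Phi>" "\<And>\<phi>. \<phi> \<in> \<Phi> \<Longrightarrow> linear \<phi>" "card \<Phi> < (card I)\<^sup>2"
  shows "\<exists>S. hermitian_on I S \<and> (\<exists>p\<in>I. \<exists>q\<in>I. S p q \<noteq> 0) \<and> (\<forall>\<phi>\<in>\<Phi>. \<phi> (mix_cov I S w) = 0)"
proof -
  \<comment> \<open>\<open>E (p, q)\<close> is the coefficient of the real unknown
    \<open>x (p, q)\<close> in \<open>mix_cov I S w\<close>. There are
    \<open>(card I)\<^sup>2\<close> unknowns against one real equation for each functional.\<close>
  define E where "E = (\<lambda>(p, q). \<chi> a c. (1 + \<i>) * (w p $ a * cnj (w q $ c))
      + (1 - \<i>) * (w q $ a * cnj (w p $ c)))"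
  have "card \<Phi> < card (I \<times> I)"
    using assms(4) by (simp add: power2_eq_square card_cartesian_product)
  then obtain x where x: "\<exists>pq\<in>I \<times> I. x pq \<noteq> 0"
      "\<forall>\<phi>\<in>\<Phi>. (\<Sum>pq\<in>I \<times> I. \<phi> (E pq) * x pq) = 0"
    using underdetermined_system[of \<Phi> "I \<times> I" "\<lambda>\<phi> pq. \<phi> (E pq)"] assms(1,2) by auto
  \<comment> \<open>The real part is symmetric and the imaginary part antisymmetric, so
    \<open>S\<close> is Hermitian. Both vanish at \<open>(p, q)\<close> only if
    \<open>x (p, q) = x (q, p) = 0\<close>, so a nonzero solution gives a nonzero
    \<open>S\<close>.\<close>
  define S where "S = (\<lambda>p q. Complex (x (p, q) + x (q, p)) (x (p, q) - x (q, p)))"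
  have "hermitian_on I S"
    by (simp add: hermitian_on_def S_def complex_eq_iff)
  moreover have "\<exists>p\<in>I. \<exists>q\<in>I. S p q \<noteq> 0"
  proof -
    obtain p q where "p \<in> I" "q \<in> I" "x (p, q) \<noteq> 0" using x(1) by auto
    moreover from this have "S p q \<noteq> 0" by (auto simp: S_def complex_eq_iff)
    ultimately show ?thesis by blast
  qed
  moreover have "\<phi> (mix_cov I S w) = 0" if "\<phi> \<in> \<Phi>" for \<phi>
  proof -
    have S: "S p q = of_real (x (p, q)) * (1 + \<i>) + of_real (x (q, p)) * (1 - \<i>)" for p q
      by (simp add: S_def complex_eq_iff)
    have "mix_cov I S w = (\<Sum>pq\<in>I \<times> I. x pq *\<^sub>R E pq)"
    proof -
      have "mix_cov I S w $ a $ c = (\<Sum>pq\<in>I \<times> I. x pq *\<^sub>R E pq) $ a $ c" for a c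
      proof -
        let ?u = "\<lambda>p q. of_real (x (p, q)) * ((1 + \<i>) * (w p $ a * cnj (w q $ c)))"
        let ?v = "\<lambda>p q. of_real (x (p, q)) * ((1 - \<i>) * (w q $ a * cnj (w p $ c)))"
        have "mix_cov I S w $ a $ c = (\<Sum>p\<in>I. \<Sum>q\<in>I. ?u p q + ?v q p)"
          unfolding mix_cov_def by (simp add: S algebra_simps)
        also have "\<dots> = (\<Sum>p\<in>I. \<Sum>q\<in>I. ?u p q) + (\<Sum>p\<in>I. \<Sum>q\<in>I. ?v q p)"
          by (simp only: sum.distrib)
        also have "(\<Sum>p\<in>I. \<Sum>q\<in>I. ?v q p) = (\<Sum>p\<in>I. \<Sum>q\<in>I. ?v p q)"
          by (rule sum.swap)
        also have "(\<Sum>p\<in>I. \<Sum>q\<in>I. ?u p q) + (\<Sum>p\<in>I. \<Sum>q\<in>I. ?v p q)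
            = (\<Sum>p\<in>I. \<Sum>q\<in>I. (x (p, q) *\<^sub>R E (p, q)) $ a $ c)"
          by (simp add: E_def sum.distrib ring_distribs scaleR_conv_of_real[where 'a=complex])
        also have "\<dots> = (\<Sum>pq\<in>I \<times> I. (x pq *\<^sub>R E pq) $ a $ c)"
          by (simp add: sum.cartesian_product case_prod_unfold)
        finally show ?thesis by simp
      qed
      then show ?thesis by (simp add: vec_eq_iff)
    qed
    then have "\<phi> (mix_cov I S w) = (\<Sum>pq\<in>I \<times> I. x pq * \<phi> (E pq))"
      using assms(3)[OF that] by (simp add: linear_sum linear_cmul)
    then show ?thesis using x(2) that by (simp add: mult.commute)
  qed
  ultimately show ?thesis by blast
qed

text \<open>One column is saved by passing from \<open>W W^H\<close> to
  \<open>W (I + r S) W^H\<close>, where every functional vanishes on \<open>W S W^H\<close> and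
  \<open>r\<close> makes \<open>I + r S\<close> positive semidefinite and singular.\<close>

lemma reduce_sensing_columns_step:
  fixes W :: "'n::finite beamformer" and \<Phi> :: "(complex^'n^'n \<Rightarrow> real) set"
  assumes "finite \<Phi>" "\<And>\<phi>. \<phi> \<in> \<Phi> \<Longrightarrow> linear \<phi>" "card \<Phi> < (length W)\<^sup>2"
  shows "\<exists>W'::'n beamformer. Suc (length W') = length W \<and>
    (\<forall>\<phi>\<in>\<Phi>. \<phi> (tx_cov W') = \<phi> (tx_cov W)) \<and> tx_power W' \<le> tx_power W"
proof -
  define m where "m = length W"
  let ?I = "{..<m}" and ?w = "\<lambda>p. W ! p"
  have "m > 0" using assms(3) by (cases "m = 0") (auto simp: m_def)
  define pw where "pw = (\<lambda>S. Re (trace (mix_cov ?I S ?w)))"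
  have pw_psd: "pw S \<ge> 0" if "psd_on ?I S" for S
    using that by (auto simp: pw_def re_trace_mix_cov psd_on_def intro: sum_nonneg)
  have neg: "mix_cov ?I (\<lambda>p q. - S p q) ?w = - mix_cov ?I S ?w" for S
    using mix_cov_scale[of ?I "-1" S ?w] by simp
  have pw_neg: "pw (\<lambda>p q. - S p q) = - pw S" for S
    by (simp add: pw_def re_trace_mix_cov hform_uminus sum_negf)
  obtain S0 where S0: "hermitian_on ?I S0" "\<exists>p\<in>?I. \<exists>q\<in>?I. S0 p q \<noteq> 0"
      "\<forall>\<phi>\<in>\<Phi>. \<phi> (mix_cov ?I S0 ?w) = 0"
    using exists_hermitian_annihilated[of ?I \<Phi> ?w] assms by (auto simp: m_def)
  have "\<not> psd_on ?I S0 \<or> \<not> psd_on ?I (\<lambda>p q. - S0 p q)"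
    using S0(2) psd_on_antisym[of ?I S0] by blast
  \<comment> \<open>A positive semidefinite matrix has nonnegative power. So if \<open>S0\<close>
    has positive power or is itself positive semidefinite, then \<open>- S0\<close> has power at
    most 0 and is not positive semidefinite.\<close>
  have "\<exists>S. hermitian_on ?I S \<and> (\<forall>\<phi>\<in>\<Phi>. \<phi> (mix_cov ?I S ?w) = 0) \<and> pw S \<le> 0 \<and> \<not> psd_on ?I S"
  proof (cases "pw S0 \<le> 0 \<and> \<not> psd_on ?I S0")
    case True
    with S0 show ?thesis by blast
  next
    case False
    have "\<not> psd_on ?I (\<lambda>p q. - S0 p q)"
      using False \<open>\<not> psd_on ?I S0 \<or> \<not> psd_on ?I (\<lambda>p q. - S0 p q)\<close>
        pw_psd[of "\<lambda>p q. - S0 p q"] pw_neg[of S0] by auto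
    moreover have "pw S0 \<ge> 0" using False pw_psd[of S0] by auto
    ultimately show ?thesis
      using S0(3) assms(2) hermitian_on_uminus[OF S0(1)]
      by (intro exI[of _ "\<lambda>p q. - S0 p q"]) (auto simp: neg pw_neg linear_neg)
  qed
  then obtain S where S: "hermitian_on ?I S" "\<forall>\<phi>\<in>\<Phi>. \<phi> (mix_cov ?I S ?w) = 0"
      "pw S \<le> 0" "\<not> psd_on ?I S" by blast
  obtain u where u: "(\<Sum>p<m. (cmod (u p))\<^sup>2) = 1"
      "\<And>x. Re (hform ?I S u) * (\<Sum>p<m. (cmod (x p))\<^sup>2) \<le> Re (hform ?I S x)"
    using hform_attains_min[OF \<open>m > 0\<close>, of S] by blast
  \<comment> \<open>The smallest eigenvalue of \<open>S\<close>; it is negative because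
    \<open>S\<close> is not positive semidefinite.\<close>
  define l where "l = Re (hform ?I S u)"
  have "l < 0"
  proof (rule ccontr)
    assume "\<not> l < 0"
    then have "0 \<le> Re (hform ?I S x)" for x
      using order.trans[OF mult_nonneg_nonneg u(2)[of x]] by (simp add: l_def sum_nonneg)
    then show False using S(1,4) by (simp add: psd_on_def)
  qed
  \<comment> \<open>The largest step for which \<open>I + r S\<close> stays positive semidefinite:
    its form is at least \<open>1 + r * l = 0\<close> on unit vectors, with equality at
    \<open>u\<close>.\<close>
  define r where "r = - 1 / l"
  have "r > 0" "r * l = -1" using \<open>l < 0\<close> by (auto simp: r_def divide_simps)
  define D where "D = (\<lambda>p q::nat. if p = q then 1 else (0::complex))"
  define A where "A = (\<lambda>p q. D p q + of_real r * S p q)"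
  have hD: "hform ?I D x = of_real (\<Sum>p<m. (cmod (x p))\<^sup>2)" for x
    unfolding of_real_sum complex_norm_square
    by (simp add: hform_def D_def if_distrib if_distribR cong: if_cong)
  have hA: "hform ?I A x = hform ?I D x + of_real r * hform ?I S x" for x
    by (simp add: hform_def A_def sum.distrib sum_distrib_left algebra_simps)
  have "hermitian_on ?I A"
    unfolding hermitian_on_def
  proof (intro ballI)
    fix p q assume "p \<in> ?I" "q \<in> ?I"
    then have "S q p = cnj (S p q)" using S(1) unfolding hermitian_on_def by blast
    then show "A q p = cnj (A p q)" by (simp add: A_def D_def)
  qed
  have "0 \<le> Re (hform ?I A x)" for x
  proof -
    let ?N = "\<Sum>p<m. (cmod (x p))\<^sup>2"
    have "r * (l * ?N) \<le> r * Re (hform ?I S x)"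
      using u(2)[of x] \<open>r > 0\<close> by (simp add: l_def)
    moreover have "r * (l * ?N) = - ?N"
      using \<open>r * l = -1\<close> by (metis mult.assoc mult_minus1)
    ultimately show ?thesis by (simp add: hA hD del: of_real_sum)
  qed
  with \<open>hermitian_on ?I A\<close> have psdA: "psd_on ?I A" by (simp add: psd_on_def)
  \<comment> \<open>\<open>l\<close> records only the real part, whereas singularity at
    \<open>u\<close> is an equation between complex numbers.\<close>
  have "hform ?I S u \<in> \<real>"
  proof -
    have "cnj (hform ?I S u) = (\<Sum>p\<in>?I. \<Sum>q\<in>?I. S q p * u q * cnj (u p))"
      unfolding hform_def cnj_sum
    proof (intro sum.cong refl)
      fix p q assume "p \<in> ?I" "q \<in> ?I"
      then have "S q p = cnj (S p q)" using S(1) unfolding hermitian_on_def by blast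
      then show "cnj (S p q * u p * cnj (u q)) = S q p * u q * cnj (u p)" by simp
    qed
    also have "\<dots> = hform ?I S u" unfolding hform_def by (rule sum.swap)
    finally show ?thesis by (simp add: Reals_cnj_iff)
  qed
  then have "hform ?I S u = of_real l" by (simp add: l_def)
  then have hu: "hform ?I A u = 0"
    using u(1) \<open>r * l = -1\<close> by (simp add: hA hD del: of_real_sum flip: of_real_mult)
  obtain a where a: "a \<in> ?I" "u a \<noteq> 0"
  proof -
    have "\<exists>a\<in>?I. u a \<noteq> 0"
    proof (rule ccontr)
      assume "\<not> (\<exists>a\<in>?I. u a \<noteq> 0)"
      then have "(\<Sum>p<m. (cmod (u p))\<^sup>2) = 0" by simp
      with u(1) show False by simp
    qed
    then show ?thesis using that by blast
  qed
  obtain b where b: "\<forall>p\<in>?I. \<forall>q\<in>?I. A p q = (\<Sum>j\<in>?I - {a}. b j p * cnj (b j q))"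
    using singular_psd_on_factor[OF _ psdA hu a] by blast
  obtain W' where W': "length W' = card (?I - {a})" "tx_cov W' = mix_cov ?I A ?w"
    using mix_cov_factor[OF _ b, of ?w] by blast
  \<comment> \<open>Along this line the functionals are constant, and the power changes by
    \<open>r * pw S\<close>, which is at most 0.\<close>
  have cov: "tx_cov W' = tx_cov W + r *\<^sub>R mix_cov ?I S ?w"
    unfolding W'(2) A_def mix_cov_add mix_cov_scale
    by (simp add: tx_cov_eq_mix_cov[of W] D_def m_def)
  have "\<phi> (tx_cov W') = \<phi> (tx_cov W)" if "\<phi> \<in> \<Phi>" for \<phi>
    using S(2) that assms(2)[OF that] unfolding cov by (simp add: linear_add linear_cmul)
  moreover have "tx_power W' = tx_power W + r * pw S"
    unfolding tx_power_def cov pw_def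
    by (simp add: trace_def sum.distrib sum_distrib_left)
  then have "tx_power W' \<le> tx_power W"
    using S(3) \<open>r > 0\<close> by (simp add: mult_nonneg_nonpos)
  moreover have "Suc (length W') = length W"
    using W'(1) a(1) by (simp add: m_def)
  ultimately show ?thesis by blast
qed

text \<open>Columns are removed one at a time for as long as the square of their number exceeds the
  number of functionals.\<close>

lemma reduce_sensing_columns:
  fixes W :: "'n::finite beamformer" and \<Phi> :: "(complex^'n^'n \<Rightarrow> real) set"
  assumes "finite \<Phi>" "\<And>\<phi>. \<phi> \<in> \<Phi> \<Longrightarrow> linear \<phi>"
  shows "\<exists>W'::'n beamformer. (length W')\<^sup>2 \<le> card \<Phi> \<and>
    (\<forall>\<phi>\<in>\<Phi>. \<phi> (tx_cov W') = \<phi> (tx_cov W)) \<and> tx_power W' \<le> tx_power W"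
proof (induction "length W" arbitrary: W rule: less_induct)
  case less
  show ?case
  proof (cases "card \<Phi> < (length W)\<^sup>2")
    case True
    then obtain W1 :: "'n beamformer" where W1: "Suc (length W1) = length W"
        "\<forall>\<phi>\<in>\<Phi>. \<phi> (tx_cov W1) = \<phi> (tx_cov W)" "tx_power W1 \<le> tx_power W"
      using reduce_sensing_columns_step[OF assms] by blast
    obtain W2 :: "'n beamformer" where "(length W2)\<^sup>2 \<le> card \<Phi>"
        "\<forall>\<phi>\<in>\<Phi>. \<phi> (tx_cov W2) = \<phi> (tx_cov W1)" "tx_power W2 \<le> tx_power W1"
      using less[of W1] W1(1) by auto
    with W1 show ?thesis by (intro exI[of _ W2]) auto
  next
    case False
    then show ?thesis by (intro exI[of _ W]) auto
  qed
qed

section \<open>Fisher information and SINR under the reduction\<close>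

lemma tx_power_append: "tx_power (V @ W) = tx_power V + tx_power W"
  by (simp add: tx_power_def tx_cov_append trace_def sum.distrib)

text \<open>With interference cancellation only the communication columns are read, so the sensing
  columns may be replaced freely.\<close>

lemma sinr_ic_take:
  assumes "k < K"
  shows "sinr_ic K chan \<sigma> (take K V) k = sinr_ic K chan \<sigma> V k"
  using assms by (simp add: sinr_ic_def)

lemma linear_re_trace_mult: "linear (\<lambda>R. Re (trace (A ** R)))"
  by (rule linearI)
     (simp_all add: trace_def matrix_matrix_mult_def sum.distrib sum_distrib_left algebra_simps)

text \<open>This symmetry reduces the number of functionals from \<open>L^2\<close> to
  \<open>L (L + 1) / 2\<close>.\<close>

lemma mean_response_gram_sym: "mean_response_gram M eta G i j = mean_response_gram M eta G j i"
  by (simp add: mean_response_gram_def response_gram_def add.commute)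

lemma bfim_cong:
  assumes "\<And>i j. Re (trace (mean_response_gram M eta G i j ** tx_cov V))
      = Re (trace (mean_response_gram M eta G i j ** tx_cov W))"
  shows "bfim M eta f G Ups \<sigma> V = bfim M eta f G Ups \<sigma> W"
  using assms by (simp add: bfim_def)

text \<open>The first \<open>K\<close> columns are kept and the reduction is applied to the others.
  The Fisher information depends on the beamformer only through trace functionals, which are
  additive over the two blocks of columns.\<close>

lemma exists_short_beamformer:
  fixes eta :: "'w \<Rightarrow> real^'l::finite"
    and G :: "real^'l \<Rightarrow> complex^'nt::finite^'nr::finite"
    and V :: "'nt beamformer"
  assumes "K \<le> length V"
  shows "\<exists>V'::'nt beamformer. K \<le> length V' \<and> length V' \<le> N_bound_ic CARD('l) K \<and>
    bfim M eta f G Ups \<sigma> V' = bfim M eta f G Ups \<sigma> V \<and>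
    (\<forall>k<K. sinr_ic K chan \<sigma> V' k = sinr_ic K chan \<sigma> V k) \<and> tx_power V' \<le> tx_power V"
proof -
  let ?\<phi> = "\<lambda>i j (R::complex^'nt^'nt). Re (trace (mean_response_gram M eta G i j ** R))"
  \<comment> \<open>Taken as a set, so that the functionals of \<open>(i, j)\<close> and
    \<open>(j, i)\<close> count once.\<close>
  define \<Phi> where "\<Phi> = range (\<lambda>(i, j). ?\<phi> i j)"
  have \<Phi>: "finite \<Phi>" "\<And>\<phi>. \<phi> \<in> \<Phi> \<Longrightarrow> linear \<phi>"
    by (auto simp: \<Phi>_def linear_re_trace_mult)
  have "2 * card \<Phi> \<le> CARD('l) * (CARD('l) + 1)"
    unfolding \<Phi>_def by (rule card_symmetric_family_le) (simp add: mean_response_gram_sym)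
  let ?C = "take K V" and ?W = "drop K V"
  obtain W' :: "'nt beamformer" where W': "(length W')\<^sup>2 \<le> card \<Phi>"
      "\<forall>\<phi>\<in>\<Phi>. \<phi> (tx_cov W') = \<phi> (tx_cov ?W)" "tx_power W' \<le> tx_power ?W"
    using reduce_sensing_columns[OF \<Phi>, of ?W] by blast
  have lenC: "length ?C = K" using assms by simp
  \<comment> \<open>The integer \<open>K + length W'\<close> is at most
    \<open>K + sqrt (L (L + 1) / 2)\<close>, hence at most its floor.\<close>
  have "2 * (length W')\<^sup>2 \<le> CARD('l) * (CARD('l) + 1)"
    using W'(1) \<open>2 * card \<Phi> \<le> CARD('l) * (CARD('l) + 1)\<close> by linarith
  then have "real (2 * (length W')\<^sup>2) \<le> real (CARD('l) * (CARD('l) + 1))"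
    by (rule of_nat_mono)
  then have "(real (length W'))\<^sup>2 \<le> real CARD('l) * (real CARD('l) + 1) / 2"
    by (simp add: algebra_simps)
  then have "real (length W') \<le> sqrt (real CARD('l) * (real CARD('l) + 1) / 2)"
    by (rule real_le_rsqrt)
  then have "K + length W' \<le> N_bound_ic CARD('l) K"
    unfolding N_bound_ic_def by (simp add: le_nat_iff le_floor_iff)
  then have "length (?C @ W') \<le> N_bound_ic CARD('l) K" using lenC by simp
  moreover have "bfim M eta f G Ups \<sigma> (?C @ W') = bfim M eta f G Ups \<sigma> V"
  proof (rule bfim_cong)
    fix i j
    have lin: "linear (?\<phi> i j)" by (rule linear_re_trace_mult)
    have "?\<phi> i j (tx_cov W') = ?\<phi> i j (tx_cov ?W)"
      using W'(2) by (auto simp: \<Phi>_def)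
    then show "?\<phi> i j (tx_cov (?C @ W')) = ?\<phi> i j (tx_cov V)"
      using tx_cov_append[of ?C ?W] linear_add[OF lin] by (simp add: tx_cov_append)
  qed
  moreover have "sinr_ic K chan \<sigma> (?C @ W') k = sinr_ic K chan \<sigma> V k" if "k < K" for k
    using sinr_ic_take[OF that, of chan \<sigma> "?C @ W'"] sinr_ic_take[OF that, of chan \<sigma> V] lenC
    by simp
  moreover have "tx_power (?C @ W') \<le> tx_power V"
    using W'(3) tx_power_append[of ?C ?W] by (simp add: tx_power_append)
  moreover have "K \<le> length (?C @ W')" using lenC by simp
  ultimately show ?thesis by blast
qed

section \<open>Optimal values and the minimum number of beamformers\<close>

text \<open>The optimisation problem prescribes the exact number of columns. Zero columns appended
  behind the communication columns change neither covariance nor SINR.\<close>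

lemma pad_beamformer:
  fixes V :: "'nt::finite beamformer"
  assumes "K \<le> length V" "length V \<le> N"
  shows "\<exists>V'::'nt beamformer. length V' = N \<and>
    bfim M eta f G Ups \<sigma> V' = bfim M eta f G Ups \<sigma> V \<and>
    (\<forall>k<K. sinr_ic K chan \<sigma> V' k = sinr_ic K chan \<sigma> V k) \<and> tx_power V' = tx_power V"
proof -
  let ?V = "V @ replicate (N - length V) 0"
  have cov: "tx_cov ?V = tx_cov V" by (simp add: tx_cov_append tx_cov_replicate_0)
  have "sinr_ic K chan \<sigma> ?V k = sinr_ic K chan \<sigma> V k" if "k < K" for k
    using sinr_ic_take[OF that, of chan \<sigma> ?V] sinr_ic_take[OF that, of chan \<sigma> V] assms by simp
  with assms cov show ?thesis
    by (intro exI[of _ ?V]) (simp add: bfim_def tx_power_def)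
qed

text \<open>The objective and its invertibility condition depend on the beamformer only through the
  Fisher information, so each feasible point with \<open>N\<close> columns has a counterpart with
  \<open>N'\<close> columns of the same value.\<close>

lemma opt_value_ic_mono:
  fixes G :: "real^'l::finite \<Rightarrow> complex^'nt::finite^'nr::finite"
  assumes "\<And>V::'nt beamformer. length V = N \<Longrightarrow> \<exists>V'::'nt beamformer. length V' = N' \<and>
    bfim M eta f G Ups \<sigma> V' = bfim M eta f G Ups \<sigma> V \<and>
    (\<forall>k<K. sinr_ic K chan \<sigma> V' k = sinr_ic K chan \<sigma> V k) \<and> tx_power V' \<le> tx_power V"
  shows "opt_value_ic M eta f G Ups \<sigma> K chan P \<phi> gam N'
    \<le> opt_value_ic M eta f G Ups \<sigma> K chan P \<phi> gam N"
  unfolding opt_value_ic_def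
proof (rule INF_mono)
  fix V assume V: "V \<in> {V \<in> feasible_ic K chan \<sigma> P gam N. invertible (bfim M eta f G Ups \<sigma> V)}"
  then obtain V' :: "'nt beamformer" where "length V' = N'"
    "bfim M eta f G Ups \<sigma> V' = bfim M eta f G Ups \<sigma> V"
    "\<forall>k<K. sinr_ic K chan \<sigma> V' k = sinr_ic K chan \<sigma> V k" "tx_power V' \<le> tx_power V"
    using assms[of V] by (auto simp: feasible_ic_def)
  with V show "\<exists>V'\<in>{V \<in> feasible_ic K chan \<sigma> P gam N'. invertible (bfim M eta f G Ups \<sigma> V)}.
      ereal (\<phi> (matrix_inv (bfim M eta f G Ups \<sigma> V')))
        \<le> ereal (\<phi> (matrix_inv (bfim M eta f G Ups \<sigma> V)))"
    by (intro bexI[of _ V']) (auto simp: feasible_ic_def)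
qed

text \<open>Padding gives one inequality between the optimal values, shortening the other; a number
  of columns within the bound therefore attains the optimal value of the full set.\<close>

lemma N_min_ic_le:
  fixes eta :: "'w \<Rightarrow> real^'l::finite"
    and G :: "real^'l \<Rightarrow> complex^'nt::finite^'nr::finite"
  shows "N_min_ic M eta f G Ups \<sigma> K chan P \<phi> gam \<le> N_bound_ic CARD('l) K"
proof -
  let ?B = "N_bound_ic CARD('l) K" and ?F = "CARD('nt) + K"
  let ?opt = "opt_value_ic M eta f G Ups \<sigma> K chan P \<phi> gam"
  \<comment> \<open>The bound may exceed \<open>CARD('nt) + K\<close>; the minimum keeps padding up
    to the full number possible.\<close>
  define N where "N = min ?B ?F"
  have "K \<le> ?B"
    unfolding N_bound_ic_def by (simp add: le_nat_iff le_floor_iff)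
  then have N: "K \<le> N" "N \<le> ?B" "N \<le> ?F" by (auto simp: N_def)
  have "?opt N = ?opt ?F"
  proof (rule antisym)
    show "?opt ?F \<le> ?opt N"
    proof (rule opt_value_ic_mono)
      fix V :: "'nt beamformer" assume "length V = N"
      then show "\<exists>V'::'nt beamformer. length V' = ?F \<and>
          bfim M eta f G Ups \<sigma> V' = bfim M eta f G Ups \<sigma> V \<and>
          (\<forall>k<K. sinr_ic K chan \<sigma> V' k = sinr_ic K chan \<sigma> V k) \<and> tx_power V' \<le> tx_power V"
        using pad_beamformer[of K V ?F] N by (metis order_refl)
    qed
    show "?opt N \<le> ?opt ?F"
    proof (cases "?F \<le> ?B")
      case True
      then show ?thesis by (simp add: N_def)
    next
      case False
      show ?thesis
      proof (rule opt_value_ic_mono)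
        fix V :: "'nt beamformer" assume "length V = ?F"
        then obtain V1 :: "'nt beamformer" where V1: "K \<le> length V1" "length V1 \<le> ?B"
          "bfim M eta f G Ups \<sigma> V1 = bfim M eta f G Ups \<sigma> V"
          "\<forall>k<K. sinr_ic K chan \<sigma> V1 k = sinr_ic K chan \<sigma> V k" "tx_power V1 \<le> tx_power V"
          using exists_short_beamformer[of K V M eta f G Ups \<sigma> chan] by auto
        \<comment> \<open>The shortened beamformer may have fewer than \<open>N\<close> columns and
          is padded back to exactly \<open>N\<close>.\<close>
        have "length V1 \<le> N" using False V1(2) by (simp add: N_def)
        then obtain V2 :: "'nt beamformer" where "length V2 = N"
          "bfim M eta f G Ups \<sigma> V2 = bfim M eta f G Ups \<sigma> V1"
          "\<forall>k<K. sinr_ic K chan \<sigma> V2 k = sinr_ic K chan \<sigma> V1 k" "tx_power V2 = tx_power V1"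
          using pad_beamformer[OF V1(1), of N M eta f G Ups \<sigma> chan] by blast
        with V1 show "\<exists>V'::'nt beamformer. length V' = N \<and>
            bfim M eta f G Ups \<sigma> V' = bfim M eta f G Ups \<sigma> V \<and>
            (\<forall>k<K. sinr_ic K chan \<sigma> V' k = sinr_ic K chan \<sigma> V k) \<and> tx_power V' \<le> tx_power V"
          by (intro exI[of _ V2]) simp
      qed
    qed
  qed
  with N(1) have "N_min_ic M eta f G Ups \<sigma> K chan P \<phi> gam \<le> N"
    unfolding N_min_ic_def by (intro Least_le) simp
  with N(2) show ?thesis by simp
qed

theorem theorem1:
  fixes M :: "'w measure"
    and eta :: "'w \<Rightarrow> real^'l::finite"
    and f :: "real^'l \<Rightarrow> real"
    and G :: "real^'l \<Rightarrow> complex^'nt::finite^'nr::finite"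
    and Ups K :: nat
    and \<sigma> P :: real
    and chan :: "nat \<Rightarrow> complex^'nt"
  assumes "prob_space M"
    and "\<And>x. 0 \<le> f x"
    and "distributed M lborel eta (\<lambda>x. ennreal (f x))"
    and "AE w in M. twice_partially_differentiable_log f (eta w)"
    and "\<And>i j. integrable M (\<lambda>w. log_prior_hessian f i j (eta w))"
    and "psd (prior_information M eta f)"
    and "\<And>x. G differentiable (at x)"
    and "\<And>i j. integrable M (\<lambda>w. response_gram G i j (eta w))"
    and "1 \<le> Ups"
    and "0 < \<sigma>\<^sup>2"
    and "0 < P"
  shows "(\<forall>(J, gam) \<in> achievable_ic M eta f G Ups \<sigma> K chan P.
            (\<forall>k<K. 0 < gam ! k) \<longrightarrow>
            (\<exists>N' V'. K \<le> N' \<and> N' \<le> N_bound_ic CARD('l) K \<and> length V' = N' \<and>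
               bfim M eta f G Ups \<sigma> V' = J \<and>
               (\<forall>k<K. gam ! k \<le> vsinr_ic K chan \<sigma> V' ! k) \<and>
               tx_power V' \<le> P)) \<and>
         (\<forall>\<phi> gam. loewner_nondecreasing \<phi> \<longrightarrow> (\<forall>k<K. 0 < gam k) \<longrightarrow>
            strictly_feasible_ic K chan \<sigma> P gam (CARD('nt) + K) \<longrightarrow>
            N_min_ic M eta f G Ups \<sigma> K chan P \<phi> gam \<le> N_bound_ic CARD('l) K)"
proof (intro conjI allI impI)
  show "\<forall>(J, gam) \<in> achievable_ic M eta f G Ups \<sigma> K chan P.
            (\<forall>k<K. 0 < gam ! k) \<longrightarrow>
            (\<exists>N' V'. K \<le> N' \<and> N' \<le> N_bound_ic CARD('l) K \<and> length V' = N' \<and>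
               bfim M eta f G Ups \<sigma> V' = J \<and>
               (\<forall>k<K. gam ! k \<le> vsinr_ic K chan \<sigma> V' ! k) \<and>
               tx_power V' \<le> P)"
  proof clarify
    fix J gam
    assume "(J, gam) \<in> achievable_ic M eta f G Ups \<sigma> K chan P"
    then obtain V :: "'nt beamformer" where V: "J = bfim M eta f G Ups \<sigma> V"
      "gam = vsinr_ic K chan \<sigma> V" "length V = CARD('nt) + K" "tx_power V \<le> P"
      by (auto simp: achievable_ic_def)
    obtain V' :: "'nt beamformer" where "K \<le> length V'" "length V' \<le> N_bound_ic CARD('l) K"
      "bfim M eta f G Ups \<sigma> V' = bfim M eta f G Ups \<sigma> V"
      "\<forall>k<K. sinr_ic K chan \<sigma> V' k = sinr_ic K chan \<sigma> V k" "tx_power V' \<le> tx_power V"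
      using exists_short_beamformer[of K V M eta f G Ups \<sigma> chan] V(3) by auto
    \<comment> \<open>The SINRs are preserved exactly, so the required inequalities hold with
      equality.\<close>
    with V show "\<exists>N' V'. K \<le> N' \<and> N' \<le> N_bound_ic CARD('l) K \<and> length V' = N' \<and>
               bfim M eta f G Ups \<sigma> V' = J \<and>
               (\<forall>k<K. gam ! k \<le> vsinr_ic K chan \<sigma> V' ! k) \<and>
               tx_power V' \<le> P"
      by (intro exI[of _ "length V'"] exI[of _ V']) (simp add: vsinr_ic_def)
  qed
qed (rule N_min_ic_le)

end
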